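(* For $n\geq 1$ let $$t_n(x)=\begin{cases}(1+x)(1-x^2)^{k-1}, & n=2k-1,\\ -(1-x^2)^k, & n=2k.\end{cases}$$ Then for every $n\geq 1$, $T_{n+1}(x)$ equals the lower Hessenberg determinant of order $n+1$ $$T_{n+1}(x)=\det(m_{i,j})_{0\leq i,j\leq n},$$ where $m_{0,0}=x$, $m_{i,0}=2^i x\,S_i(x)$ for $1\leq i\leq n$, $m_{i,j}=\binom{i}{j-1}t_{i-j+1}(x)$ for $1\leq j\leq i\leq n$, $m_{i,i+1}=-1$ for $0\leq i\leq n-1$, and $m_{i,j}=0$ for $j>i+1$.
   Context: Alternating runs of a word of distinct integers are its maximal monotone (increasing or decreasing) segments of consecutive entries of length at least two. The up-down run polynomials are $S_n(x)=\sum_{\pi\in\mathfrak{S}_n}x^{\mathrm{as}(\pi)}$, where $\mathfrak{S}_n$ is the symmetric group on $\{1,\ldots,n\}$ and $\mathrm{as}(\pi)$ is the number of alternating runs of the word $0\,\pi(1)\cdots\pi(n)$ (equivalently, the maximal length of a subsequence with $\pi(i_1)>\pi(i_2)<\pi(i_3)>\cdots$); $S_1=x$, $S_2=x+x^2$. A signed permutation $\pi$ in the hyperoctahedral group $\mathcal{B}_n$ is a bijection of $\{\pm1,\ldots,\pm n\}$ with $\pi(-i)=-\pi(i)$, identified with the word $\pi(0)\pi(1)\cdots\pi(n)$, where $\pi(0)=0$; its alternating runs are those of this word. $\pi$ is an up signed permutation if $\pi(1)>0$. $T(n,k)$ is the number of up signed permutations in $\mathcal{B}_n$ with exactly $k$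 alternating runs, and $T_n(x)=\sum_{k=1}^nT(n,k)x^k$ (type $B$ alternating run polynomials over up signed permutations). E.g. $T_1=x$, $T_2=x+3x^2$, $T_3=x+12x^2+11x^3$. It is known (Zhao) that $T(n,k)=(2k-1)T(n-1,k)+3T(n-1,k-1)+(2n-2k+2)T(n-1,k-2)$ for $n\geq 2$, $1\leq k\leq n$. *)

theory Defs
  imports
    "HOL-Combinatorics.Permutations"
    "HOL-Computational_Algebra.Polynomial"
    "Jordan_Normal_Form.Determinant"
begin

text \<open>
  A segment of consecutive entries of a word is represented by the pair of its first and last
  (0-based) positions; \<open>i < j\<close> says that it has length at least two.
\<close>

definition monotone_segment :: "'a::linorder list \<Rightarrow> nat \<Rightarrow> nat \<Rightarrow> bool" where
  "monotone_segment w i j \<longleftrightarrow>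
     i < j \<and> j < length w \<and>
     (strict_mono_on {i..j} (\<lambda>k. w ! k) \<or> strict_antimono_on {i..j} (\<lambda>k. w ! k))"

definition alternating_run :: "'a::linorder list \<Rightarrow> nat \<Rightarrow> nat \<Rightarrow> bool" where
  "alternating_run w i j \<longleftrightarrow>
     monotone_segment w i j \<and>
     (\<forall>i' j'. monotone_segment w i' j' \<and> i' \<le> i \<and> j \<le> j' \<longrightarrow> i' = i \<and> j' = j)"

definition num_alternating_runs :: "'a::linorder list \<Rightarrow> nat" where
  "num_alternating_runs w = card {(i, j). alternating_run w i j}"

text \<open>
  A function that permutes \<open>{1..n}\<close> fixes 0, so \<open>map \<pi> [0..<Suc n]\<close> below is the word
  \<open>0 \<pi>(1) \<dots> \<pi>(n)\<close>. The same remark applies to signed permutations.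
\<close>

definition up_down_run_poly :: "nat \<Rightarrow> int poly" where
  "up_down_run_poly n =
     (\<Sum>\<pi> | \<pi> permutes {1..n}. monom 1 (num_alternating_runs (map \<pi> [0..<Suc n])))"

definition signed_permutations :: "nat \<Rightarrow> (int \<Rightarrow> int) set" where
  "signed_permutations n =
     {\<pi>. \<pi> permutes ({- int n..int n} - {0}) \<and> (\<forall>i. \<pi> (- i) = - \<pi> i)}"

definition up_signed_permutations :: "nat \<Rightarrow> (int \<Rightarrow> int) set" where
  "up_signed_permutations n = {\<pi> \<in> signed_permutations n. \<pi> 1 > 0}"

definition up_signed_run_number :: "nat \<Rightarrow> nat \<Rightarrow> nat" where
  "up_signed_run_number n k =
     card {\<pi> \<in> up_signed_permutations n. num_alternating_runs (map \<pi> [0..int n]) = k}"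

definition up_signed_run_poly :: "nat \<Rightarrow> int poly" where
  "up_signed_run_poly n = (\<Sum>k = 1..n. monom (int (up_signed_run_number n k)) k)"

abbreviation poly_x :: "int poly" where
  "poly_x \<equiv> [:0, 1:]"

text \<open>
  Only used for \<open>n \<ge> 1\<close>. The exponent is \<open>k - 1\<close> when \<open>n = 2k - 1\<close> and \<open>k\<close> when \<open>n = 2k\<close>.
\<close>

definition t_poly :: "nat \<Rightarrow> int poly" where
  "t_poly n =
     (if odd n then (1 + poly_x) * (1 - poly_x ^ 2) ^ ((n - 1) div 2)
      else - ((1 - poly_x ^ 2) ^ (n div 2)))"

definition hessenberg_entry :: "nat \<Rightarrow> nat \<Rightarrow> int poly" where
  "hessenberg_entry i j =
     (if j = 0 then (if i = 0 then poly_x else 2 ^ i * poly_x * up_down_run_poly i)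
      else if j \<le> i then of_nat (i choose (j - 1)) * t_poly (i - j + 1)
      else if j = i + 1 then - 1
      else 0)"

end

theory Submission
  imports Defs
begin

text \<open>
  Let \<open>t(z)\<close>, \<open>S(z)\<close> and \<open>U(z)\<close> be the exponential generating functions of \<open>t\<^sub>n\<close> for \<open>n \<ge> 1\<close>, of \<open>S\<^sub>n\<close>
  for \<open>n \<ge> 0\<close> and of \<open>T\<^sub>n\<^sub>+\<^sub>1\<close> for \<open>n \<ge> 0\<close>. Expanding a lower Hessenberg determinant with superdiagonal
  \<open>- 1\<close> gives a recurrence for its leading principal minors (\<open>det_hessenberg\<close>), and for the matrix in
  question this recurrence is the coefficientwise form of \<open>U(z) = x S(2 z) + t(z) U(z)\<close>. So the
  theorem amounts to the identity \<open>x S(2 z) = (1 - t(z)) U(z)\<close>, which is \<open>scaled_up_down_run_poly_eq_convolution\<close>.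

  No closed form of these functions is needed to see this. Each of the three sequences
  \<open>2 ^ n x S\<^sub>n\<close>, \<open>T\<^sub>n\<^sub>+\<^sub>1\<close> and \<open>1, - t\<^sub>1, - t\<^sub>2, \<dots>\<close> satisfies a recurrence of the form
  \<open>f\<^sub>n\<^sub>+\<^sub>1 = a f\<^sub>n' + (p + n b) f\<^sub>n\<close> with the same \<open>a = 2 x (1 - x\<^sup>2)\<close> and \<open>b = 2 x\<^sup>2\<close>. Such recurrences are
  compatible with binomial convolution, under which the constants \<open>p\<close> add up
  (\<open>binomial_convolution_recurrence\<close>), and the constants here fit:
  \<open>(3 x - 1 + 2 x\<^sup>2) + (- 1 - x) = 2 x - 2 + 2 x\<^sup>2\<close>.

  The recurrence of \<open>t\<^sub>n\<close> is a calculation. Those of \<open>S\<^sub>n\<close> and \<open>T\<^sub>n\<close> come from inserting the letter of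
  largest absolute value into a shorter word. How the number of alternating runs then changes
  depends only on the number of runs, the length and the first step of the shorter word
  (\<open>run_count_insert_max\<close>). For this purpose the number of runs is computed by recursion
  on the word: it increases by one at each turn.
\<close>

section \<open>Counting alternating runs letter by letter\<close>

lemma monotone_on_atLeastAtMost_iff_steps:
  fixes f :: "nat \<Rightarrow> 'a"
  assumes "transp R"
  shows "monotone_on {i..j} (<) R f \<longleftrightarrow> (\<forall>k. i \<le> k \<and> k < j \<longrightarrow> R (f k) (f (Suc k)))"
proof
  assume "monotone_on {i..j} (<) R f"
  then show "\<forall>k. i \<le> k \<and> k < j \<longrightarrow> R (f k) (f (Suc k))"
    by (auto simp: monotone_on_def)
next
  assume steps: "\<forall>k. i \<le> k \<and> k < j \<longrightarrow> R (f k) (f (Suc k))"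
  have "R (f a) (f b)" if "a < b" "i \<le> a" "b \<le> j" for a b
    using that
  proof (induction b)
    case (Suc b)
    show ?case
    proof (cases "a = b")
      case True
      then show ?thesis using steps Suc.prems by auto
    next
      case False
      then have "R (f a) (f b)" "R (f b) (f (Suc b))" using Suc steps by auto
      then show ?thesis using assms by (blast dest: transpD)
    qed
  qed simp
  then show "monotone_on {i..j} (<) R f" by (auto simp: monotone_on_def)
qed

text \<open>
  When adjacent letters differ, every step of a word goes strictly up or strictly down, so a segment
  is monotone as soon as all its steps agree with the first one in the truth value of \<open><\<close>.
  This treats the increasing and the decreasing case at once.
\<close>

lemma monotone_segment_iff_steps:
  assumes "distinct_adj w"
  shows "monotone_segment w i j \<longleftrightarrow> i < j \<and> j < length w \<and>
    (\<forall>k. i \<le> k \<and> k < j \<longrightarrow> (w ! k < w ! Suc k \<longleftrightarrow> w ! i < w ! Suc i))"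
proof -
  have ne: "w ! k > w ! Suc k \<longleftrightarrow> \<not> w ! k < w ! Suc k" if "Suc k < length w" for k
    using assms that by (auto simp: distinct_adj_conv_nth not_less order_le_less)
  have up: "strict_mono_on {i..j} ((!) w) \<longleftrightarrow> (\<forall>k. i \<le> k \<and> k < j \<longrightarrow> w ! k < w ! Suc k)"
    by (rule monotone_on_atLeastAtMost_iff_steps) auto
  have down: "strict_antimono_on {i..j} ((!) w) \<longleftrightarrow> (\<forall>k. i \<le> k \<and> k < j \<longrightarrow> w ! k > w ! Suc k)"
    by (rule monotone_on_atLeastAtMost_iff_steps) (auto simp: transp_def)
  have down': "(\<forall>k. i \<le> k \<and> k < j \<longrightarrow> w ! k > w ! Suc k)
      \<longleftrightarrow> (\<forall>k. i \<le> k \<and> k < j \<longrightarrow> \<not> w ! k < w ! Suc k)" if "j < length w"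
    using ne that by auto
  show ?thesis
  proof (cases "i < j \<and> j < length w")
    case True
    then show ?thesis unfolding monotone_segment_def up down
      using down' by blast
  qed (auto simp: monotone_segment_def)
qed

text \<open>
  The positions where a maximal monotone segment begins: the first position, and every interior
  position at which the word turns.
\<close>

definition run_starts :: "'a::linorder list \<Rightarrow> nat set" where
  "run_starts w = {i. Suc i < length w \<and> (i = 0 \<or> \<not> monotone_segment w (i - 1) (Suc i))}"

lemma run_starts_altdef:
  assumes "distinct_adj w"
  shows "run_starts w = {i. Suc i < length w \<and>
    (i = 0 \<or> (w ! (i - 1) < w ! i) \<noteq> (w ! i < w ! Suc i))}"
proof -
  have "monotone_segment w (i - 1) (Suc i) \<longleftrightarrow> (w ! (i - 1) < w ! i) = (w ! i < w ! Suc i)"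
    if "0 < i" "Suc i < length w" for i
  proof -
    obtain m where i: "i = Suc m" using \<open>0 < i\<close> by (cases i) auto
    have "m \<le> k \<and> k < Suc (Suc m) \<longleftrightarrow> k = m \<or> k = Suc m" for k by auto
    then show ?thesis
      using that unfolding monotone_segment_iff_steps[OF assms] i by auto
  qed
  then show ?thesis unfolding run_starts_def by blast
qed

text \<open>
  Two monotone segments that share a step have the same direction and hence glue to a longer one.
  So a maximal segment cannot start in the middle of a monotone stretch; conversely, the longest
  monotone segment from a turning position cannot be extended to the left.
\<close>

lemma ex_alternating_run_iff_start:
  assumes "distinct_adj w"
  shows "(\<exists>j. alternating_run w i j) \<longleftrightarrow> i \<in> run_starts w"
proof
  assume "\<exists>j. alternating_run w i j"
  then obtain j where run: "alternating_run w i j" ..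
  then have seg: "monotone_segment w i j" by (simp add: alternating_run_def)
  then have ij: "i < j" "j < length w" by (auto simp: monotone_segment_def)
  have "\<not> monotone_segment w (i - 1) (Suc i)" if "i > 0"
  proof
    assume "monotone_segment w (i - 1) (Suc i)"
    then have "(w ! k < w ! Suc k) = (w ! (i - 1) < w ! Suc (i - 1))" if "i - 1 \<le> k" "k < Suc i" for k
      using that unfolding monotone_segment_iff_steps[OF assms] by blast
    moreover have "(w ! k < w ! Suc k) = (w ! i < w ! Suc i)" if "i \<le> k" "k < j" for k
      using that seg unfolding monotone_segment_iff_steps[OF assms] by blast
    moreover have "i \<le> k \<or> k = i - 1" if "i - 1 \<le> k" for k using that by auto
    ultimately have "monotone_segment w (i - 1) j"
      unfolding monotone_segment_iff_steps[OF assms] using ij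
      by (metis lessI less_imp_diff_less diff_le_self)
    then have "i - 1 = i" using run unfolding alternating_run_def
      by (meson diff_le_self order_refl)
    then show False using \<open>i > 0\<close> by simp
  qed
  then show "i \<in> run_starts w" using ij by (auto simp: run_starts_def)
next
  assume start: "i \<in> run_starts w"
  define j where "j = Max {j. monotone_segment w i j}"
  have fin: "finite {j. monotone_segment w i j}"
    by (rule finite_subset[of _ "{..<length w}"]) (auto simp: monotone_segment_def)
  have "monotone_segment w i (Suc i)"
    using start unfolding monotone_segment_iff_steps[OF assms] run_starts_def
    by (auto simp: less_Suc_eq_le dest: antisym)
  then have j: "monotone_segment w i j"
    using Max_in[OF fin] by (auto simp: j_def)
  have "i' = i \<and> j' = j"
    if seg: "monotone_segment w i' j'" and "i' \<le> i" "j \<le> j'" for i' j'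
  proof -
    have "i < j" using j by (simp add: monotone_segment_def)
    have "i' = i"
    proof (rule ccontr)
      assume "i' \<noteq> i"
      then have "i' \<le> i - 1" "0 < i" "Suc i \<le> j'"
        using that \<open>i < j\<close> by auto
      then have "monotone_segment w (i - 1) (Suc i)"
        using seg monotone_on_subset[of "{i'..j'}" _ _ _ "{i - 1..Suc i}"]
        unfolding monotone_segment_def by auto
      then show False using start \<open>0 < i\<close> by (auto simp: run_starts_def)
    qed
    moreover from this have "j' \<le> j" using Max_ge[OF fin] seg by (auto simp: j_def)
    ultimately show ?thesis using that by auto
  qed
  then show "\<exists>j. alternating_run w i j" using j by (auto simp: alternating_run_def)
qed

text \<open>
  Two runs with the same start are nested, hence equal by maximality.
\<close>

lemma num_alternating_runs_eq_card_starts: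
  assumes "distinct_adj w"
  shows "num_alternating_runs w = card (run_starts w)"
proof -
  have "inj_on fst {(i, j). alternating_run w i j}"
    unfolding inj_on_def alternating_run_def by clarsimp (metis linear order_refl)
  moreover have "fst ` {(i, j). alternating_run w i j} = run_starts w"
    using ex_alternating_run_iff_start[OF assms] by force
  ultimately show ?thesis
    unfolding num_alternating_runs_def by (metis card_image)
qed

fun run_count :: "'a::linorder list \<Rightarrow> nat" where
  "run_count (a # b # c # w) = run_count (b # c # w) + (if (a < b) = (b < c) then 0 else 1)"
| "run_count [a, b] = 1"
| "run_count _ = 0"

text \<open>
  Prepending \<open>a\<close> shifts all starts of \<open>b # c # w\<close> by one. The new word has the additional
  start 0, and the shifted start of \<open>b\<close> survives exactly if the word turns at \<open>b\<close>.
\<close>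

lemma card_run_starts:
  "distinct_adj w \<Longrightarrow> card (run_starts w) = run_count w"
proof (induction w rule: run_count.induct)
  case (1 a b c w)
  let ?v = "b # c # w"
  have fin: "finite (run_starts ?v)"
    by (rule finite_subset[of _ "{..<length ?v}"]) (auto simp: run_starts_def)
  have d: "distinct_adj ?v" using 1 by simp
  have zero: "0 \<in> run_starts ?v" by (simp add: run_starts_def)
  let ?T = "if (a < b) = (b < c) then Suc ` (run_starts ?v - {0}) else Suc ` run_starts ?v"
  have "i \<in> run_starts (a # ?v) \<longleftrightarrow> i \<in> insert 0 ?T" for i
  proof (cases i)
    case 0
    then show ?thesis by (simp add: run_starts_def)
  next
    case (Suc m)
    then show ?thesis
      unfolding run_starts_altdef[OF 1(2)] run_starts_altdef[OF d]
      by (cases m) auto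
  qed
  then have "run_starts (a # ?v) = insert 0 ?T" by blast
  moreover have "0 \<notin> ?T" "finite ?T" using fin by auto
  moreover have "card ?T = card (run_starts ?v) - (if (a < b) = (b < c) then 1 else 0)"
    using zero fin by (simp add: card_image card_Diff_singleton)
  moreover have "card (run_starts ?v) > 0" using zero fin by (auto simp: card_gt_0_iff)
  ultimately show ?case using 1 by (simp split: if_splits)
next
  case (2 a b)
  have "run_starts [a, b] = {0}" by (auto simp: run_starts_def)
  then show ?case by simp
qed (auto simp: run_starts_def)

lemma num_alternating_runs_eq_run_count:
  "distinct_adj w \<Longrightarrow> num_alternating_runs w = run_count w"
  by (simp add: num_alternating_runs_eq_card_starts card_run_starts)

lemma distinct_imp_distinct_adj: "distinct w \<Longrightarrow> distinct_adj w"
  by (simp add: distinct_adj_conv_nth nth_eq_iff_index_eq)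

lemma run_count_bounds:
  "run_count (a # b # w) \<in> {1..Suc (length w)}"
proof (induction w arbitrary: a b)
  case (Cons c w)
  have "run_count (b # c # w) \<in> {1..Suc (length w)}" by (rule Cons.IH)
  then show ?case by auto
qed simp

text \<open>
  The first letter enters only through the direction of the first step.
\<close>

lemma run_count_cong_first:
  "(a < b) = (a' < b) \<Longrightarrow> run_count (a # b # w) = run_count (a' # b # w)"
  by (cases w) auto

lemma run_count_uminus:
  fixes w :: "int list"
  assumes "distinct_adj w"
  shows "run_count (map uminus w) = run_count w"
  using assms
proof (induction w rule: run_count.induct)
  case (1 a b c w)
  then show ?case by auto
qed auto

section \<open>Inserting a letter into a word\<close>

fun insertions :: "'a \<Rightarrow> 'a list \<Rightarrow> 'a list list" where
  "insertions e [] = [[e]]"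
| "insertions e (y # ys) = (e # y # ys) # map (Cons y) (insertions e ys)"

lemma set_insertions: "set (insertions e ys) = {us @ e # vs | us vs. us @ vs = ys}"
proof (induction ys)
  case (Cons y ys)
  have "{us @ e # vs | us vs. us @ vs = y # ys} =
      insert (e # y # ys) (Cons y ` {us @ e # vs | us vs. us @ vs = ys})"
  proof (intro Set.set_eqI iffI)
    fix zs assume "zs \<in> {us @ e # vs | us vs. us @ vs = y # ys}"
    then obtain us vs where "zs = us @ e # vs" "us @ vs = y # ys" by blast
    then show "zs \<in> insert (e # y # ys) (Cons y ` {us @ e # vs | us vs. us @ vs = ys})"
      by (cases us) auto
  next
    fix zs assume "zs \<in> insert (e # y # ys) (Cons y ` {us @ e # vs | us vs. us @ vs = ys})"
    then consider "zs = [] @ e # y # ys" | us vs where "zs = (y # us) @ e # vs" "us @ vs = ys"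
      by auto
    then show "zs \<in> {us @ e # vs | us vs. us @ vs = y # ys}"
    proof cases
      case 1
      then show ?thesis by blast
    next
      case 2
      then have "(y # us) @ vs = y # ys" by simp
      with 2(1) show ?thesis by blast
    qed
  qed
  then show ?case using Cons by simp
qed auto

lemma distinct_insertions: "e \<notin> set ys \<Longrightarrow> distinct (insertions e ys)"
  by (induction ys) (auto simp: distinct_map)

lemma insertions_map: "insertions (f e) (map f ys) = map (map f) (insertions e ys)"
  by (induction ys) (simp_all add: comp_def)

text \<open>
  The distribution of the number of runs when a new maximum is inserted somewhere after the first
  letter of a word with \<open>k\<close> runs. The number of runs is kept if the maximum is placed directly before
  or after an interior peak, or at the end of a word whose last step goes up; in a typical other
  gap it creates two new turns, and it creates one new turn at the remaining places near the two
  ends of the word. Counting peaks gives the coefficients, which depend only on \<open>k\<close>, the length of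
  the word and the direction of its first step.

  The induction removes the first letter \<open>a\<close>. This changes the number of runs of all results by the
  same amount, with the exception of those where the maximum stands directly before or after \<open>b\<close>:
  there a step at \<open>b\<close> is a new one. These two terms are split off and compared by cases on the
  directions of the next steps.
\<close>

lemma run_count_insert_max:
  fixes x :: "'r::comm_ring_1"
  assumes "distinct_adj (a # b # w)" "\<forall>y\<in>set (a # b # w). y < e"
  shows "(\<Sum>zs\<leftarrow>insertions e (b # w). x ^ run_count (a # zs)) =
    (let k = run_count (a # b # w); K = of_nat k; L = of_nat (length (b # w)) in
     if a < b then K * x ^ k + x ^ (k + 1) + (L - K) * x ^ (k + 2)
     else (K - 1) * x ^ k + 2 * x ^ (k + 1) + (L - K) * x ^ (k + 2))"
  using assms
proof (induction w arbitrary: a b)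
  case Nil
  then show ?case by (auto simp: not_less_iff_gr_or_eq)
next
  case (Cons c r)
  define t :: nat where "t = (if (a < b) = (b < c) then 0 else 1)"
  have IH: "(\<Sum>zs\<leftarrow>insertions e (c # r). x ^ run_count (b # zs)) =
    (let k = run_count (b # c # r); K = of_nat k; L = of_nat (length (c # r)) in
     if b < c then K * x ^ k + x ^ (k + 1) + (L - K) * x ^ (k + 2)
     else (K - 1) * x ^ k + 2 * x ^ (k + 1) + (L - K) * x ^ (k + 2))"
    using Cons by simp
  have "(\<Sum>zs\<leftarrow>insertions e (b # c # r). x ^ run_count (a # zs)) =
      x ^ run_count (a # e # b # c # r) + x ^ run_count (a # b # e # c # r)
      + (\<Sum>zs\<leftarrow>insertions e r. x ^ (run_count (b # c # zs) + t))"
    by (simp add: comp_def t_def add.assoc)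
  also have "(\<Sum>zs\<leftarrow>insertions e r. x ^ (run_count (b # c # zs) + t)) =
      x ^ t * ((\<Sum>zs\<leftarrow>insertions e (c # r). x ^ run_count (b # zs)) - x ^ run_count (b # e # c # r))"
    by (simp add: comp_def power_add mult.commute[of _ "x ^ t"] flip: sum_list_const_mult)
  finally have eq: "(\<Sum>zs\<leftarrow>insertions e (b # c # r). x ^ run_count (a # zs)) =
      x ^ run_count (a # e # b # c # r) + x ^ run_count (a # b # e # c # r)
      + x ^ t * ((\<Sum>zs\<leftarrow>insertions e (c # r). x ^ run_count (b # zs)) - x ^ run_count (b # e # c # r))" .
  have "a < e" "b < e" "c < e" "a \<noteq> b" "b \<noteq> c" "\<not> e < a" "\<not> e < b" "\<not> e < c" using Cons.prems by auto
  (* The subtracted term has e next to c, so it depends on the direction of the step after c. *)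
  show ?case
  proof (cases r)
    case Nil
    then show ?thesis unfolding eq IH
      using \<open>a < e\<close> \<open>b < e\<close> \<open>c < e\<close> \<open>a \<noteq> b\<close> \<open>b \<noteq> c\<close> \<open>\<not> e < a\<close> \<open>\<not> e < b\<close> \<open>\<not> e < c\<close>
      by (auto simp: t_def Let_def algebra_simps eval_nat_numeral)
  next
    case (Cons d r')
    then have "c \<noteq> d" "d < e" "\<not> e < d" using Cons.prems by auto
    then show ?thesis unfolding eq IH unfolding Cons
      using \<open>a < e\<close> \<open>b < e\<close> \<open>c < e\<close> \<open>a \<noteq> b\<close> \<open>b \<noteq> c\<close> \<open>\<not> e < a\<close> \<open>\<not> e < b\<close> \<open>\<not> e < c\<close>
      by (auto simp: t_def Let_def algebra_simps eval_nat_numeral)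
  qed
qed

section \<open>Permutations and signed permutations as words\<close>

text \<open>
  With the identity as level these are the words of the permutations of \<open>{1..n}\<close>, and with the
  absolute value on the integers those of the signed permutations. In both cases a word of order
  \<open>n + 1\<close> arises in exactly one way from one of order \<open>n\<close> by inserting a letter of level \<open>n + 1\<close>.
\<close>

definition leveled_words :: "('a \<Rightarrow> nat) \<Rightarrow> nat \<Rightarrow> 'a list set" where
  "leveled_words lev n = {zs. distinct (map lev zs) \<and> lev ` set zs = {1..n}}"

lemma leveled_words_0 [simp]: "leveled_words lev 0 = {[]}"
  by (auto simp: leveled_words_def)

lemma length_leveled_words: "zs \<in> leveled_words lev n \<Longrightarrow> length zs = n"
  using distinct_card[of "map lev zs"] by (simp add: leveled_words_def)

lemma leveled_words_Suc:
  "leveled_words lev (Suc n) =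
     (\<Union>(ys, e) \<in> leveled_words lev n \<times> {e. lev e = Suc n}. set (insertions e ys))"
proof (intro equalityI subsetI)
  fix zs assume zs: "zs \<in> leveled_words lev (Suc n)"
  then have "Suc n \<in> lev ` set zs" by (simp add: leveled_words_def)
  then obtain us e vs where split: "zs = us @ e # vs" and e: "lev e = Suc n"
    by (metis (no_types, lifting) image_iff split_list)
  have "insert (Suc n) (lev ` set (us @ vs)) = insert (Suc n) {1..n}"
    and "Suc n \<notin> lev ` set (us @ vs)" and "distinct (map lev (us @ vs))"
    using zs e unfolding leveled_words_def split by (auto simp: image_Un)
  then have "us @ vs \<in> leveled_words lev n"
    unfolding leveled_words_def by (auto simp: insert_ident)
  then show "zs \<in> (\<Union>(ys, e) \<in> leveled_words lev n \<times> {e. lev e = Suc n}. set (insertions e ys))"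
    using e split by (force simp: set_insertions)
next
  fix zs
  assume "zs \<in> (\<Union>(ys, e) \<in> leveled_words lev n \<times> {e. lev e = Suc n}. set (insertions e ys))"
  then obtain us e vs where split: "zs = us @ e # vs" and e: "lev e = Suc n"
    and "us @ vs \<in> leveled_words lev n"
    by (auto simp: set_insertions)
  then have "lev ` set (us @ vs) = {1..n}" "distinct (map lev (us @ vs))"
    by (auto simp: leveled_words_def)
  moreover from this have "Suc n \<notin> lev ` set (us @ vs)" by simp
  then have "Suc n \<notin> lev ` set us" "Suc n \<notin> lev ` set vs" by (auto simp only: set_append image_Un)
  moreover have "lev ` set zs = insert (Suc n) (lev ` set (us @ vs))" using split e by auto
  ultimately show "zs \<in> leveled_words lev (Suc n)"
    using split e unfolding leveled_words_def by (simp add: atLeastAtMostSuc_conv)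
qed

lemma finite_leveled_words:
  assumes "\<And>m. finite {e. lev e = m}"
  shows "finite (leveled_words lev n)"
proof (induction n)
  case (Suc n)
  then show ?case unfolding leveled_words_Suc using assms by auto
qed simp

text \<open>
  Removing the letter of top level recovers both the shorter word and the inserted letter, so the
  sets of insertions for different pairs are disjoint.
\<close>

lemma sum_leveled_words_Suc:
  fixes f :: "'a list \<Rightarrow> 'r::comm_monoid_add"
  assumes fin: "\<And>m. finite {e. lev e = m}"
  shows "(\<Sum>zs\<in>leveled_words lev (Suc n). f zs) =
    (\<Sum>ys\<in>leveled_words lev n. \<Sum>e | lev e = Suc n. \<Sum>zs\<leftarrow>insertions e ys. f zs)"
proof -
  let ?I = "leveled_words lev n \<times> {e. lev e = Suc n}"
  have notin: "Suc n \<notin> lev ` set ys" if "ys \<in> leveled_words lev n" for ys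
    using that by (simp add: leveled_words_def)
  have recover: "filter (\<lambda>z. lev z \<noteq> Suc n) zs = ys \<and> filter (\<lambda>z. lev z = Suc n) zs = [e]"
    if ys: "ys \<in> leveled_words lev n" and e: "lev e = Suc n" and zs: "zs \<in> set (insertions e ys)"
    for ys e zs
  proof -
    obtain us vs where "zs = us @ e # vs" "ys = us @ vs"
      using zs unfolding set_insertions by blast
    moreover from this have "\<forall>z\<in>set us \<union> set vs. lev z \<noteq> Suc n"
      using notin[OF ys] by force
    ultimately show ?thesis using e by (auto simp: filter_id_conv filter_empty_conv)
  qed
  have disj: "p = q"
    if "p \<in> ?I" "q \<in> ?I" "zs \<in> set (insertions (snd p) (fst p))" "zs \<in> set (insertions (snd q) (fst q))"
    for p q zs
    using recover[of "fst p" "snd p" zs] recover[of "fst q" "snd q" zs] that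
    by (auto simp: prod_eq_iff)
  have "(\<Sum>zs\<in>leveled_words lev (Suc n). f zs)
      = (\<Sum>p\<in>?I. \<Sum>zs\<in>set (insertions (snd p) (fst p)). f zs)"
    unfolding leveled_words_Suc case_prod_beta
    by (rule sum.UNION_disjoint) (use fin finite_leveled_words[OF fin] disj in auto)
  also have "\<dots> = (\<Sum>p\<in>?I. \<Sum>zs\<leftarrow>insertions (snd p) (fst p). f zs)"
    by (intro sum.cong refl sum.distinct_set_conv_list distinct_insertions) (use notin in force)
  also have "\<dots> = (\<Sum>ys\<in>leveled_words lev n. \<Sum>e | lev e = Suc n. \<Sum>zs\<leftarrow>insertions e ys. f zs)"
    by (simp add: sum.cartesian_product case_prod_beta)
  finally show ?thesis .
qed

lemma bij_betw_permutations_words: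
  "bij_betw (\<lambda>\<pi>. map \<pi> [1..<Suc n]) {\<pi>. \<pi> permutes {1..n}} (leveled_words (\<lambda>k. k) n)"
proof (rule bij_betwI')
  fix \<pi> \<rho> assume \<pi>\<rho>: "\<pi> \<in> {\<pi>. \<pi> permutes {1..n}}" "\<rho> \<in> {\<pi>. \<pi> permutes {1..n}}"
  show "(map \<pi> [1..<Suc n] = map \<rho> [1..<Suc n]) = (\<pi> = \<rho>)"
  proof
    assume "map \<pi> [1..<Suc n] = map \<rho> [1..<Suc n]"
    then have "\<pi> i = \<rho> i" if "i \<in> {1..n}" for i using that by (simp del: upt_Suc)
    moreover have "\<pi> i = \<rho> i" if "i \<notin> {1..n}" for i
      using \<pi>\<rho> permutes_not_in[OF _ that, of \<pi>] permutes_not_in[OF _ that, of \<rho>] by simp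
    ultimately show "\<pi> = \<rho>" by blast
  qed simp
next
  fix \<pi> assume "\<pi> \<in> {\<pi>. \<pi> permutes {1..n}}"
  then show "map \<pi> [1..<Suc n] \<in> leveled_words (\<lambda>k. k) n"
    using permutes_image[of \<pi> "{1..n}"] permutes_inj_on[of \<pi> "{1..n}" "{1..n}"]
    by (simp add: leveled_words_def distinct_map atLeastLessThanSuc_atLeastAtMost del: upt_Suc)
next
  fix zs assume zs: "zs \<in> leveled_words (\<lambda>k. k) n"
  then have len: "length zs = n" by (rule length_leveled_words)
  define \<pi> where "\<pi> i = (if i \<in> {1..n} then zs ! (i - 1) else i)" for i
  have "bij_betw (\<lambda>i. i - 1) {1..n} {..<length zs}"
    by (rule bij_betw_byWitness[of _ Suc]) (auto simp: len)
  moreover have "bij_betw ((!) zs) {..<length zs} {1..n}"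
    using zs by (intro bij_betw_nth) (auto simp: leveled_words_def)
  ultimately have "bij_betw ((!) zs \<circ> (\<lambda>i. i - 1)) {1..n} {1..n}"
    by (rule bij_betw_trans)
  moreover have "bij_betw ((!) zs \<circ> (\<lambda>i. i - 1)) {1..n} {1..n} \<longleftrightarrow> bij_betw \<pi> {1..n} {1..n}"
    by (rule bij_betw_cong) (simp add: \<pi>_def)
  ultimately have "\<pi> permutes {1..n}"
    by (intro bij_imp_permutes) (auto simp: \<pi>_def)
  moreover have "map \<pi> [1..<Suc n] = zs"
    by (rule nth_equalityI) (auto simp: \<pi>_def len simp del: upt_Suc)
  ultimately show "\<exists>\<pi>\<in>{\<pi>. \<pi> permutes {1..n}}. zs = map \<pi> [1..<Suc n]" by auto
qed

abbreviation abs_level :: "int \<Rightarrow> nat" where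
  "abs_level e \<equiv> nat \<bar>e\<bar>"

lemma finite_abs_level: "finite {e. abs_level e = m}"
  by (rule finite_subset[of _ "{- int m..int m}"]) auto

lemma abs_level_eq_Suc: "{e. abs_level e = Suc n} = {int (Suc n), - int (Suc n)}"
  by auto

text \<open>
  A signed permutation is determined by its values at the positive integers. Conversely, a word
  extends to an odd function, which is injective because the absolute values of the letters of
  the word are pairwise distinct.
\<close>

lemma bij_betw_signed_permutations_words:
  "bij_betw (\<lambda>\<pi>. map \<pi> [1..int n]) (signed_permutations n) (leveled_words abs_level n)"
proof (rule bij_betwI')
  fix \<pi> \<rho> assume \<pi>\<rho>: "\<pi> \<in> signed_permutations n" "\<rho> \<in> signed_permutations n"
  show "(map \<pi> [1..int n] = map \<rho> [1..int n]) = (\<pi> = \<rho>)"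
  proof
    assume eq: "map \<pi> [1..int n] = map \<rho> [1..int n]"
    have pos: "\<pi> i = \<rho> i" if "i \<in> {1..int n}" for i using eq that by auto
    show "\<pi> = \<rho>"
    proof
      fix i :: int
      have neg: "\<pi> i = - \<pi> (- i)" "\<rho> i = - \<rho> (- i)" if "- i \<in> {1..int n}"
        using \<pi>\<rho> by (auto simp: signed_permutations_def)
      have perm: "\<pi> permutes ({- int n..int n} - {0})" "\<rho> permutes ({- int n..int n} - {0})"
        using \<pi>\<rho> by (simp_all add: signed_permutations_def)
      have "i \<in> {1..int n} \<or> - i \<in> {1..int n} \<or> i \<notin> {- int n..int n} - {0}"
        unfolding atLeastAtMost_iff Diff_iff singleton_iff by linarith
      then consider "i \<in> {1..int n}" | "- i \<in> {1..int n}" | "i \<notin> {- int n..int n} - {0}"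
        by blast
      then show "\<pi> i = \<rho> i"
      proof cases
        case 1
        then show ?thesis by (rule pos)
      next
        case 2
        then show ?thesis using neg pos by metis
      next
        case 3
        from permutes_not_in[OF perm(1) this] permutes_not_in[OF perm(2) this]
        show ?thesis by (rule trans[OF _ sym])
      qed
    qed
  qed simp
next
  fix \<pi> assume "\<pi> \<in> signed_permutations n"
  then have p: "\<pi> permutes ({- int n..int n} - {0})" and neg: "\<pi> (- i) = - \<pi> i" for i
    by (auto simp: signed_permutations_def)
  have "inj_on (\<lambda>i. abs_level (\<pi> i)) {1..int n}"
  proof (rule inj_onI)
    fix i j assume ij: "i \<in> {1..int n}" "j \<in> {1..int n}" "abs_level (\<pi> i) = abs_level (\<pi> j)"
    then have "\<pi> i = \<pi> j \<or> \<pi> i = \<pi> (- j)" using neg by auto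
    then have "i = j \<or> i = - j" using permutes_inj[OF p] by (auto dest: injD)
    then show "i = j" using ij by auto
  qed
  moreover have "(\<lambda>i. abs_level (\<pi> i)) ` {1..int n} \<subseteq> {1..n}"
  proof
    fix k assume "k \<in> (\<lambda>i. abs_level (\<pi> i)) ` {1..int n}"
    then obtain i where "i \<in> {1..int n}" "k = abs_level (\<pi> i)" by blast
    moreover from this have "\<pi> i \<in> {- int n..int n} - {0}" using permutes_in_image[OF p, of i] by auto
    ultimately show "k \<in> {1..n}" by auto
  qed
  ultimately have "(\<lambda>i. abs_level (\<pi> i)) ` {1..int n} = {1..n}"
    by (intro card_subset_eq) (auto simp: card_image)
  moreover from \<open>inj_on _ _\<close> have "distinct (map (\<lambda>i. abs_level (\<pi> i)) [1..int n])"
    by (simp add: distinct_map)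
  ultimately show "map \<pi> [1..int n] \<in> leveled_words abs_level n"
    by (simp add: leveled_words_def image_image comp_def)
next
  fix zs assume zs: "zs \<in> leveled_words abs_level n"
  then have len: "length zs = n" by (rule length_leveled_words)
  let ?D = "{- int n..int n} - {0}"
  define \<pi> where "\<pi> i = (if i \<in> ?D then sgn i * zs ! (abs_level i - 1) else i)" for i
  have level: "abs_level (zs ! k) \<in> {1..n}" if "k < n" for k
    using zs that len nth_mem unfolding leveled_words_def by blast
  have bound: "abs_level i - 1 < n" if "i \<in> ?D" for i using that by auto
  have abs: "abs_level (\<pi> i) = abs_level (zs ! (abs_level i - 1))" if "i \<in> ?D" for i
    using that by (auto simp: \<pi>_def abs_mult abs_sgn_eq)
  have "\<pi> ` ?D \<subseteq> ?D"
  proof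
    fix k assume "k \<in> \<pi> ` ?D"
    then obtain i where "i \<in> ?D" "k = \<pi> i" by blast
    then have "abs_level k \<in> {1..n}" using abs level bound by metis
    then show "k \<in> ?D" by auto
  qed
  moreover have "inj_on \<pi> ?D"
  proof (rule inj_onI)
    fix i j assume ij: "i \<in> ?D" "j \<in> ?D" "\<pi> i = \<pi> j"
    then have eq: "map abs_level zs ! (abs_level i - 1) = map abs_level zs ! (abs_level j - 1)"
      using abs bound len by (metis nth_map)
    have dist: "distinct (map abs_level zs)" using zs by (simp add: leveled_words_def)
    have less: "abs_level k - 1 < length (map abs_level zs)" if "k \<in> ?D" for k
      using bound[OF that] by (simp only: length_map len)
    have "abs_level i - 1 = abs_level j - 1"
      using nth_eq_iff_index_eq[OF dist less[OF ij(1)] less[OF ij(2)]] eq by (rule iffD1)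
    moreover have "abs_level i \<ge> 1" "abs_level j \<ge> 1" using ij(1,2) by auto
    ultimately have "\<bar>i\<bar> = \<bar>j\<bar>" by linarith
    have "sgn i = sgn j"
    proof -
      let ?z = "zs ! (abs_level i - 1)"
      have "?z \<noteq> 0" using level[OF bound[OF ij(1)]] by auto
      moreover have "\<pi> i = sgn i * ?z" "\<pi> j = sgn j * ?z"
        using ij(1,2) \<open>\<bar>i\<bar> = \<bar>j\<bar>\<close> by (simp_all only: \<pi>_def if_True)
      ultimately show ?thesis using ij(3) by simp
    qed
    with \<open>\<bar>i\<bar> = \<bar>j\<bar>\<close> show "i = j" by (metis mult_sgn_abs)
  qed
  ultimately have "bij_betw \<pi> ?D ?D"
    by (simp add: bij_betw_def endo_inj_surj)
  then have "\<pi> permutes ?D" by (intro bij_imp_permutes) (auto simp: \<pi>_def)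
  moreover have "\<pi> (- i) = - \<pi> i" for i by (auto simp: \<pi>_def)
  ultimately have "\<pi> \<in> signed_permutations n" by (simp add: signed_permutations_def)
  moreover have "map \<pi> [1..int n] = zs"
  proof (rule nth_equalityI)
    fix k assume "k < length (map \<pi> [1..int n])"
    then have "k < n" by simp
    then have "map \<pi> [1..int n] ! k = \<pi> (1 + int k)" by simp
    also have "\<dots> = zs ! k" using \<open>k < n\<close> by (simp add: \<pi>_def nat_add_distrib)
    finally show "map \<pi> [1..int n] ! k = zs ! k" .
  qed (simp add: len)
  ultimately show "\<exists>\<pi>\<in>signed_permutations n. zs = map \<pi> [1..int n]" by auto
qed

section \<open>Derivatives of integer polynomials\<close>

lemma pderiv_sum: "pderiv (\<Sum>i\<in>A. f i) = (\<Sum>i\<in>A. pderiv (f i))"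
  by (induction A rule: infinite_finite_induct) (simp_all add: pderiv_add)

lemma pderiv_of_nat_mult: "pderiv (of_nat k * p) = of_nat k * pderiv (p :: 'a::idom poly)"
  by (simp add: pderiv_mult)

lemma pderiv_x: "pderiv poly_x = 1"
  by (simp add: pderiv_pCons)

text \<open>
  The operator \<open>x d/dx\<close> multiplies \<open>x ^ k\<close> by \<open>k\<close>. It translates coefficients that depend on the
  number of runs into derivatives.
\<close>

lemma x_times_pderiv_x_power: "poly_x * pderiv (poly_x ^ k) = of_nat k * poly_x ^ k"
proof (induction k)
  case (Suc k)
  have "poly_x * pderiv (poly_x ^ Suc k) = poly_x * (poly_x * pderiv (poly_x ^ k)) + poly_x * poly_x ^ k"
    unfolding power_Suc pderiv_mult pderiv_x by (simp only: algebra_simps)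
  then show ?case unfolding Suc.IH by (simp add: algebra_simps del: mult_pCons_left mult_pCons_right)
qed simp

text \<open>
  The factor \<open>1 - x\<^sup>2\<close> restores the exponent that differentiation lowers, which avoids \<open>k - 1\<close>.
\<close>

lemma pderiv_one_minus_x2_power:
  "(1 - poly_x ^ 2) * pderiv ((1 - poly_x ^ 2) ^ k) = - (of_nat (2 * k) * poly_x * (1 - poly_x ^ 2) ^ k)"
proof (induction k)
  case (Suc k)
  define x where "x = poly_x"
  define y where "y = 1 - x ^ 2"
  have IH: "y * pderiv (y ^ k) = - (of_nat (2 * k) * x * y ^ k)"
    using Suc.IH by (simp only: x_def y_def)
  have "pderiv x = 1" by (simp add: x_def pderiv_x)
  then have "pderiv y = - 2 * x"
    by (simp add: y_def power2_eq_square pderiv_diff pderiv_mult)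
  then have "y * pderiv (y ^ Suc k) = y * (y * pderiv (y ^ k)) + y * (y ^ k * (- 2 * x))"
    unfolding power_Suc pderiv_mult by (simp only: algebra_simps)
  also have "\<dots> = - (of_nat (2 * Suc k) * x * y ^ Suc k)"
    unfolding IH by (simp add: algebra_simps)
  finally show ?case by (simp only: x_def y_def)
qed simp

lemma monom_eq_of_nat_times_power: "monom (int c) k = of_nat c * poly_x ^ k"
  by (simp add: monom_altdef of_nat_poly)

lemma monom_1_eq_power: "monom 1 k = poly_x ^ k"
  by (simp add: monom_altdef)

section \<open>The recurrence of the up-down run polynomials\<close>

lemma up_down_run_poly_eq_sum_words:
  "up_down_run_poly n = (\<Sum>zs\<in>leveled_words (\<lambda>k. k) n. poly_x ^ run_count (0 # zs))"
proof -
  have "up_down_run_poly n = (\<Sum>\<pi> | \<pi> permutes {1..n}. poly_x ^ run_count (0 # map \<pi> [1..<Suc n]))"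
    unfolding up_down_run_poly_def
  proof (rule sum.cong[OF refl])
    fix \<pi> assume "\<pi> \<in> {\<pi>. \<pi> permutes {1..n}}"
    then have \<pi>: "\<pi> permutes {1..n}" by simp
    have "map \<pi> [0..<Suc n] = 0 # map \<pi> [1..<Suc n]"
      using permutes_not_in[OF \<pi>, of 0] by (simp add: upt_conv_Cons del: upt_Suc)
    moreover have "distinct (map \<pi> [0..<Suc n])"
      using inj_on_subset[OF permutes_inj[OF \<pi>] subset_UNIV] by (simp add: distinct_map del: upt_Suc)
    ultimately show "monom 1 (num_alternating_runs (map \<pi> [0..<Suc n]))
        = poly_x ^ run_count (0 # map \<pi> [1..<Suc n])"
      by (simp only: num_alternating_runs_eq_run_count distinct_imp_distinct_adj monom_1_eq_power)
  qed
  also have "\<dots> = (\<Sum>zs\<in>leveled_words (\<lambda>k. k) n. poly_x ^ run_count (0 # zs))"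
    by (rule sum.reindex_bij_betw[OF bij_betw_permutations_words])
  finally show ?thesis .
qed

lemma up_down_run_poly_0: "up_down_run_poly 0 = 1"
  by (simp add: up_down_run_poly_eq_sum_words)

text \<open>
  The first step of \<open>0 \<pi>(1) \<dots> \<pi>(n)\<close> goes up, so inserting \<open>n + 1\<close> into a word with \<open>k\<close> runs
  contributes \<open>k x ^ k + x ^ (k + 1) + (n - k) x ^ (k + 2)\<close>. The one-letter word, with \<open>n = k = 0\<close>,
  fits the same formula.
\<close>

lemma up_down_run_poly_Suc:
  "up_down_run_poly (Suc n) = poly_x * (1 - poly_x ^ 2) * pderiv (up_down_run_poly n)
     + (poly_x + of_nat n * poly_x ^ 2) * up_down_run_poly n"
proof -
  let ?W = "leveled_words (\<lambda>k::nat. k) n"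
  have "up_down_run_poly (Suc n)
      = (\<Sum>ys\<in>?W. \<Sum>zs\<leftarrow>insertions (Suc n) ys. poly_x ^ run_count (0 # zs))"
    unfolding up_down_run_poly_eq_sum_words by (subst sum_leveled_words_Suc) auto
  also have "\<dots> = (\<Sum>ys\<in>?W. poly_x * (1 - poly_x ^ 2) * pderiv (poly_x ^ run_count (0 # ys))
      + (poly_x + of_nat n * poly_x ^ 2) * poly_x ^ run_count (0 # ys))"
  proof (rule sum.cong[OF refl])
    fix ys assume ys: "ys \<in> ?W"
    define k where "k = run_count (0 # ys)"
    define x where "x = poly_x"
    have len: "length ys = n" and mem: "set ys = {1..n}" and dist: "distinct ys"
      using ys length_leveled_words[OF ys] by (auto simp: leveled_words_def)
    have "(\<Sum>zs\<leftarrow>insertions (Suc n) ys. x ^ run_count (0 # zs))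
        = of_nat k * x ^ k + x ^ (k + 1) + (of_nat n - of_nat k) * x ^ (k + 2)"
    proof (cases ys)
      case Nil
      then show ?thesis using len by (simp add: k_def)
    next
      case (Cons b w)
      have "distinct (0 # ys)" "\<forall>y\<in>set (0 # ys). y < Suc n" using mem dist by auto
      moreover have "b \<in> {1..n}" using Cons unfolding mem[symmetric] by simp
      then have "0 < b" by simp
      ultimately show ?thesis
        using run_count_insert_max[of 0 b w "Suc n" x] Cons len
        by (simp only: k_def Let_def distinct_imp_distinct_adj if_True)
    qed
    also have "\<dots> = (1 - x ^ 2) * (of_nat k * x ^ k) + (x + of_nat n * x ^ 2) * x ^ k"
      by (simp add: algebra_simps power2_eq_square)
    also have "\<dots> = x * (1 - x ^ 2) * pderiv (x ^ k) + (x + of_nat n * x ^ 2) * x ^ k"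
      unfolding x_def x_times_pderiv_x_power[symmetric] by (simp only: ac_simps)
    finally show "(\<Sum>zs\<leftarrow>insertions (Suc n) ys. poly_x ^ run_count (0 # zs)) =
        poly_x * (1 - poly_x ^ 2) * pderiv (poly_x ^ run_count (0 # ys))
      + (poly_x + of_nat n * poly_x ^ 2) * poly_x ^ run_count (0 # ys)"
      by (simp only: x_def k_def)
  qed
  also have "\<dots> = poly_x * (1 - poly_x ^ 2) * pderiv (up_down_run_poly n)
     + (poly_x + of_nat n * poly_x ^ 2) * up_down_run_poly n"
    unfolding up_down_run_poly_eq_sum_words pderiv_sum by (simp only: sum.distrib sum_distrib_left)
  finally show ?thesis .
qed

section \<open>The recurrence of the type B alternating run polynomials\<close>

definition up_words :: "nat \<Rightarrow> int list set" where
  "up_words n = {zs \<in> leveled_words abs_level n. hd zs > 0}"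

text \<open>
  The sum over \<open>k\<close> in the definition loses nothing, since a word with \<open>n + 1 \<ge> 2\<close> letters has at
  least one and at most \<open>n\<close> runs.
\<close>

lemma up_signed_run_poly_eq_sum_words:
  assumes "n \<ge> 1"
  shows "up_signed_run_poly n = (\<Sum>zs\<in>up_words n. poly_x ^ run_count (0 # zs))"
proof -
  let ?r = "\<lambda>\<pi>. run_count (0 # map \<pi> [1..int n])"
  have word: "[0..int n] = 0 # [1..int n]" "[1..int n] = 1 # [2..int n]"
    using assms by (simp_all add: upto_rec1)
  have runs: "num_alternating_runs (map \<pi> [0..int n]) = ?r \<pi>" if "\<pi> \<in> signed_permutations n" for \<pi>
  proof -
    have \<pi>: "\<pi> permutes ({- int n..int n} - {0})" using that by (simp add: signed_permutations_def)
    have "map \<pi> [0..int n] = 0 # map \<pi> [1..int n]"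
      using permutes_not_in[OF \<pi>, of 0] by (simp add: word(1))
    moreover have "distinct (map \<pi> [0..int n])"
      using inj_on_subset[OF permutes_inj[OF \<pi>] subset_UNIV] by (simp add: distinct_map)
    ultimately show ?thesis
      by (simp only: num_alternating_runs_eq_run_count distinct_imp_distinct_adj)
  qed
  have fin: "finite (leveled_words abs_level n)" by (rule finite_leveled_words) (rule finite_abs_level)
  then have fin': "finite (signed_permutations n)"
    using bij_betw_finite[OF bij_betw_signed_permutations_words] by blast
  then have fin_up: "finite (up_signed_permutations n)" by (simp add: up_signed_permutations_def)
  have bounds: "?r \<pi> \<in> {1..n}" for \<pi>
  proof -
    have "Suc (nat (int n - 1)) = n" using assms by simp
    then show ?thesis using run_count_bounds[of 0 "\<pi> 1" "map \<pi> [2..int n]"] by (simp add: word(2))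
  qed
  have "up_signed_run_poly n
      = (\<Sum>k=1..n. \<Sum>\<pi>\<in>{\<pi> \<in> up_signed_permutations n. ?r \<pi> = k}. poly_x ^ ?r \<pi>)"
    unfolding up_signed_run_poly_def
  proof (rule sum.cong[OF refl])
    fix k
    have "{\<pi> \<in> up_signed_permutations n. num_alternating_runs (map \<pi> [0..int n]) = k}
        = {\<pi> \<in> up_signed_permutations n. ?r \<pi> = k}"
      using runs by (auto simp: up_signed_permutations_def)
    then have "monom (int (up_signed_run_number n k)) k
        = of_nat (card {\<pi> \<in> up_signed_permutations n. ?r \<pi> = k}) * poly_x ^ k"
      by (simp only: up_signed_run_number_def monom_eq_of_nat_times_power)
    also have "\<dots> = (\<Sum>\<pi>\<in>{\<pi> \<in> up_signed_permutations n. ?r \<pi> = k}. poly_x ^ k)" by simp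
    also have "\<dots> = (\<Sum>\<pi>\<in>{\<pi> \<in> up_signed_permutations n. ?r \<pi> = k}. poly_x ^ ?r \<pi>)"
      by (rule sum.cong) auto
    finally show "monom (int (up_signed_run_number n k)) k = \<dots>" .
  qed
  also have "\<dots> = (\<Sum>\<pi>\<in>up_signed_permutations n. poly_x ^ ?r \<pi>)"
    by (intro sum.group fin_up finite_atLeastAtMost image_subsetI bounds)
  also have "\<dots> = (\<Sum>\<pi>\<in>signed_permutations n. if hd (map \<pi> [1..int n]) > 0 then poly_x ^ ?r \<pi> else 0)"
    unfolding up_signed_permutations_def sum.inter_filter[OF fin'] by (simp add: word(2))
  also have "\<dots> = (\<Sum>zs\<in>leveled_words abs_level n. if hd zs > 0 then poly_x ^ run_count (0 # zs) else 0)"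
    by (rule sum.reindex_bij_betw[OF bij_betw_signed_permutations_words])
  also have "\<dots> = (\<Sum>zs\<in>up_words n. poly_x ^ run_count (0 # zs))"
    unfolding up_words_def sum.inter_filter[OF fin] ..
  finally show ?thesis .
qed

lemma up_signed_run_poly_1: "up_signed_run_poly 1 = poly_x"
proof -
  have words: "leveled_words abs_level (Suc 0) = {[1], [-1]}"
    unfolding leveled_words_Suc abs_level_eq_Suc by auto
  have "up_words (Suc 0) = {[1]}" unfolding up_words_def words by (intro equalityI subsetI) auto
  then show ?thesis by (simp add: up_signed_run_poly_eq_sum_words)
qed

text \<open>
  This is Zhao's recurrence for the coefficients. Let \<open>M = n + 1\<close> and let \<open>ys\<close> be an up word of
  order \<open>n\<close> whose extension by the initial 0 has \<open>k\<close> runs. Inserting \<open>M\<close> anywhere gives the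
  coefficients \<open>k\<close>, \<open>1\<close>, \<open>n - k\<close> of \<open>x ^ k\<close>, \<open>x ^ (k + 1)\<close>, \<open>x ^ (k + 2)\<close>. Inserting \<open>- M\<close> amounts,
  after changing all signs, to inserting \<open>M\<close> into a word whose first step goes down; it gives
  \<open>k - 1\<close>, \<open>2\<close>, \<open>n - k\<close>, but one of these words, the one that starts with \<open>- M\<close> and has \<open>k + 1\<close> runs, is
  not an up word. In exchange there are the up words that start with \<open>M\<close> and lose this property when
  \<open>M\<close> is deleted: they are \<open>M\<close> followed by the negative of an up word \<open>ys\<close>, and they also have
  \<open>k + 1\<close> runs. The total is \<open>2 k - 1\<close>, \<open>3\<close>, \<open>2 (n - k)\<close>.
\<close>

lemma up_signed_run_poly_Suc:
  assumes "n \<ge> 1"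
  shows "up_signed_run_poly (Suc n) = 2 * poly_x * (1 - poly_x ^ 2) * pderiv (up_signed_run_poly n)
     + (3 * poly_x - 1 + of_nat n * (2 * poly_x ^ 2)) * up_signed_run_poly n"
proof -
  define x where "x = poly_x"
  define g where "g zs = x ^ run_count (0 # zs)" for zs :: "int list"
  let ?W = "leveled_words abs_level n"
  let ?M = "int (Suc n)"
  let ?up = "\<lambda>zs. if hd zs > 0 then g zs else 0"
  have finW: "finite (leveled_words abs_level k)" for k
    by (rule finite_leveled_words) (rule finite_abs_level)
  have word: "ys \<noteq> [] \<and> length ys = n \<and> distinct (0 # ys) \<and> (\<forall>y\<in>set ys. \<bar>y\<bar> < ?M)" if "ys \<in> ?W" for ys
  proof -
    have "distinct (map abs_level ys)" "abs_level ` set ys = {1..n}"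
      using that by (auto simp: leveled_words_def)
    moreover from this have "abs_level y \<in> {1..n}" if "y \<in> set ys" for y using that by blast
    ultimately have "distinct ys" "\<And>y. y \<in> set ys \<Longrightarrow> y \<noteq> 0 \<and> \<bar>y\<bar> < ?M"
      by (force simp: distinct_map)+
    then show ?thesis using length_leveled_words[OF that] assms by auto
  qed
  (* Only the first insertion, in front of the whole word, affects the sign of the first letter. *)
  have insert_neg: "(\<Sum>zs\<leftarrow>insertions (- ?M) ys. ?up zs) =
      (if hd ys > 0 then (\<Sum>zs\<leftarrow>insertions (- ?M) ys. g zs) - g (- ?M # ys) else 0)"
    and insert_pos: "(\<Sum>zs\<leftarrow>insertions ?M ys. ?up zs) =
      (if hd ys > 0 then (\<Sum>zs\<leftarrow>insertions ?M ys. g zs) else g (?M # ys))" if "ys \<in> ?W" for ys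
  proof -
    obtain b w where "ys = b # w" using word[OF \<open>ys \<in> ?W\<close>] by (cases ys) auto
    then show "(\<Sum>zs\<leftarrow>insertions (- ?M) ys. ?up zs) =
      (if hd ys > 0 then (\<Sum>zs\<leftarrow>insertions (- ?M) ys. g zs) - g (- ?M # ys) else 0)"
      "(\<Sum>zs\<leftarrow>insertions ?M ys. ?up zs) =
      (if hd ys > 0 then (\<Sum>zs\<leftarrow>insertions ?M ys. g zs) else g (?M # ys))"
      by (simp_all add: comp_def)
  qed
  (* Changing all signs exchanges up words and down words. *)
  have "bij_betw (map uminus) (up_words n) {ys \<in> ?W. \<not> hd ys > 0}"
  proof (rule bij_betw_byWitness[of _ "map uminus"])
    have neg: "map uminus ys \<in> ?W \<and> hd (map uminus ys) = - hd ys \<and> hd ys \<noteq> 0" if "ys \<in> ?W" for ys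
      using that word[OF that]
      by (cases ys) (auto simp: leveled_words_def comp_def image_image)
    show "map uminus ` up_words n \<subseteq> {ys \<in> ?W. \<not> hd ys > 0}"
      using neg unfolding up_words_def by force
    show "map uminus ` {ys \<in> ?W. \<not> hd ys > 0} \<subseteq> up_words n"
      using neg unfolding up_words_def by force
  qed (auto simp: comp_def)
  then have flip: "(\<Sum>ys | ys \<in> ?W \<and> \<not> hd ys > 0. g (?M # ys)) = (\<Sum>ys\<in>up_words n. g (?M # map uminus ys))"
    by (rule sum.reindex_bij_betw[symmetric])
  have "up_signed_run_poly (Suc n) = (\<Sum>zs\<in>leveled_words abs_level (Suc n). ?up zs)"
    unfolding up_signed_run_poly_eq_sum_words[OF le_SucI[OF assms]] up_words_def g_def x_def
    by (rule sum.inter_filter) (rule finW)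
  also have "\<dots> = (\<Sum>ys\<in>?W. (\<Sum>zs\<leftarrow>insertions ?M ys. ?up zs) + (\<Sum>zs\<leftarrow>insertions (- ?M) ys. ?up zs))"
    unfolding sum_leveled_words_Suc[of abs_level, OF finite_abs_level] abs_level_eq_Suc by simp
  also have "\<dots> = (\<Sum>ys\<in>?W. (if hd ys > 0 then (\<Sum>zs\<leftarrow>insertions ?M ys. g zs)
        + (\<Sum>zs\<leftarrow>insertions (- ?M) ys. g zs) - g (- ?M # ys) else 0)
      + (if \<not> hd ys > 0 then g (?M # ys) else 0))"
    by (rule sum.cong[OF refl]) (simp only: insert_neg insert_pos, simp)
  also have "\<dots> = (\<Sum>ys\<in>up_words n. (\<Sum>zs\<leftarrow>insertions ?M ys. g zs)
        + (\<Sum>zs\<leftarrow>insertions (- ?M) ys. g zs) - g (- ?M # ys) + g (?M # map uminus ys))"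
    unfolding sum.distrib sum.inter_filter[OF finW, symmetric] flip by (simp add: up_words_def)
  also have "\<dots> = (\<Sum>ys\<in>up_words n. 2 * x * (1 - x ^ 2) * pderiv (g ys)
      + (3 * x - 1 + of_nat n * (2 * x ^ 2)) * g ys)"
  proof (rule sum.cong[OF refl])
    fix ys assume "ys \<in> up_words n"
    then have ys: "ys \<in> ?W" and "hd ys > 0" by (auto simp: up_words_def)
    then obtain b w where ys_eq: "ys = b # w" and "b > 0" using word by (cases ys) auto
    define k where "k = run_count (0 # ys)"
    let ?ys' = "map uminus ys"
    have dist: "distinct_adj (0 # ys)" using word[OF ys] by (simp add: distinct_imp_distinct_adj)
    have "distinct (map uminus (0 # ys))" using word[OF ys] by (auto simp: distinct_map)
    then have dist': "distinct_adj (0 # ?ys')" by (simp add: distinct_imp_distinct_adj)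
    have k': "run_count (0 # ?ys') = k" using run_count_uminus[OF dist] by (simp add: k_def)
    have len: "length (b # w) = n" and len': "length (- b # map uminus w) = n"
      using word[OF ys] by (simp_all add: ys_eq)
    have bound: "\<forall>y\<in>set (0 # b # w). y < ?M" and bound': "\<forall>y\<in>set (0 # - b # map uminus w). y < ?M"
      using word[OF ys] by (auto simp: ys_eq abs_less_iff)
    have "\<not> 0 < - b" using \<open>b > 0\<close> by simp
    have max: "(\<Sum>zs\<leftarrow>insertions ?M ys. g zs)
        = of_nat k * x ^ k + x ^ (k + 1) + (of_nat n - of_nat k) * x ^ (k + 2)"
      using run_count_insert_max[OF dist[unfolded ys_eq] bound, of x] \<open>b > 0\<close>
      by (simp only: g_def k_def ys_eq Let_def len if_True)
    have adj: "distinct_adj (0 # zs)" if "zs \<in> set (insertions (- ?M) ys)" for zs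
    proof -
      obtain us vs where "zs = us @ (- ?M) # vs" "us @ vs = ys" using \<open>zs \<in> _\<close> unfolding set_insertions by blast
      moreover have "- ?M \<notin> set ys" using word[OF ys] by force
      ultimately have "distinct (0 # zs)" using word[OF ys] by auto
      then show ?thesis by (rule distinct_imp_distinct_adj)
    qed
    have "(\<Sum>zs\<leftarrow>insertions (- ?M) ys. g zs) = (\<Sum>zs\<leftarrow>insertions (- ?M) ys. g (map uminus zs))"
      unfolding g_def using run_count_uminus[OF adj] by (intro arg_cong[of _ _ sum_list] map_cong) auto
    also have "\<dots> = (\<Sum>zs\<leftarrow>insertions ?M ?ys'. g zs)"
      using insertions_map[of uminus "- ?M" ys] by (simp only: minus_minus map_map comp_def)
    also have "\<dots> = (of_nat k - 1) * x ^ k + 2 * x ^ (k + 1) + (of_nat n - of_nat k) * x ^ (k + 2)"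
      using run_count_insert_max[OF dist'[unfolded ys_eq list.map] bound', of x] k' \<open>\<not> 0 < - b\<close>
      by (simp only: g_def ys_eq list.map Let_def len' if_False)
    finally have min: "(\<Sum>zs\<leftarrow>insertions (- ?M) ys. g zs) = \<dots>" .
    have "g (- ?M # ys) = x ^ (k + 1)"
      using run_count_cong_first[of "- ?M" b 0 w] \<open>b > 0\<close> by (simp add: g_def k_def ys_eq)
    moreover have "g (?M # ?ys') = x ^ (k + 1)"
      using run_count_cong_first[of "?M" "- b" 0 "map uminus w"] \<open>b > 0\<close> k' by (simp add: g_def ys_eq)
    ultimately have "(\<Sum>zs\<leftarrow>insertions ?M ys. g zs) + (\<Sum>zs\<leftarrow>insertions (- ?M) ys. g zs)
          - g (- ?M # ys) + g (?M # ?ys')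
        = 2 * (1 - x ^ 2) * (of_nat k * x ^ k) + (3 * x - 1 + of_nat n * (2 * x ^ 2)) * x ^ k"
      unfolding max min by (simp add: algebra_simps power2_eq_square)
    also have "\<dots> = 2 * x * (1 - x ^ 2) * pderiv (x ^ k) + (3 * x - 1 + of_nat n * (2 * x ^ 2)) * x ^ k"
      unfolding x_def x_times_pderiv_x_power[symmetric] by (simp only: ac_simps)
    finally show "(\<Sum>zs\<leftarrow>insertions ?M ys. g zs) + (\<Sum>zs\<leftarrow>insertions (- ?M) ys. g zs)
          - g (- ?M # ys) + g (?M # ?ys')
        = 2 * x * (1 - x ^ 2) * pderiv (g ys) + (3 * x - 1 + of_nat n * (2 * x ^ 2)) * g ys"
      by (simp only: g_def k_def)
  qed
  also have "\<dots> = 2 * x * (1 - x ^ 2) * pderiv (up_signed_run_poly n)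
     + (3 * x - 1 + of_nat n * (2 * x ^ 2)) * up_signed_run_poly n"
    unfolding up_signed_run_poly_eq_sum_words[OF assms] pderiv_sum g_def x_def
    by (simp only: sum.distrib sum_distrib_left)
  finally show ?thesis by (simp only: x_def)
qed

section \<open>Binomial convolution\<close>

text \<open>
  Pascal's rule, in the form of Leibniz' rule for the derivative of a product of exponential
  generating functions.
\<close>

lemma sum_choose_Suc:
  fixes F :: "nat \<Rightarrow> nat \<Rightarrow> 'r::comm_semiring_1"
  shows "(\<Sum>m\<le>Suc n. of_nat (Suc n choose m) * F m (Suc n - m)) =
    (\<Sum>m\<le>n. of_nat (n choose m) * (F (Suc m) (n - m) + F m (Suc (n - m))))"
proof -
  have "(\<Sum>m\<le>Suc n. of_nat (Suc n choose m) * F m (Suc n - m)) =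
      F 0 (Suc n) + (\<Sum>m\<le>n. of_nat (n choose Suc m) * F (Suc m) (n - m))
      + (\<Sum>m\<le>n. of_nat (n choose m) * F (Suc m) (n - m))"
    by (subst sum.atMost_Suc_shift) (simp add: algebra_simps sum.distrib)
  also have "F 0 (Suc n) + (\<Sum>m\<le>n. of_nat (n choose Suc m) * F (Suc m) (n - m))
      = (\<Sum>m\<le>Suc n. of_nat (n choose m) * F m (Suc n - m))"
    by (subst sum.atMost_Suc_shift) simp
  also have "\<dots> = (\<Sum>m\<le>n. of_nat (n choose m) * F m (Suc (n - m)))"
    by (simp add: Suc_diff_le binomial_eq_0)
  finally show ?thesis by (simp add: algebra_simps sum.distrib)
qed

text \<open>
  If \<open>F\<close> and \<open>G\<close> are the exponential generating functions in \<open>z\<close> of \<open>f\<close> and \<open>g\<close>, the hypotheses say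
  \<open>(1 - b z) F\<^sub>z = a F\<^sub>x + p F\<close> and \<open>(1 - b z) G\<^sub>z = a G\<^sub>x + q G\<close>. The product rules
  in \<open>z\<close> and in \<open>x\<close> then give the same equation for \<open>F G\<close>, with \<open>p + q\<close> in the place of \<open>p\<close>.
\<close>

lemma binomial_convolution_recurrence:
  fixes f g :: "nat \<Rightarrow> 'a::idom poly"
  assumes f: "\<And>m. f (Suc m) = a * pderiv (f m) + (p + of_nat m * b) * f m"
    and g: "\<And>m. g (Suc m) = a * pderiv (g m) + (q + of_nat m * b) * g m"
  defines "h \<equiv> \<lambda>n. \<Sum>m\<le>n. of_nat (n choose m) * (f m * g (n - m))"
  shows "h (Suc n) = a * pderiv (h n) + (p + q + of_nat n * b) * h n"
proof -
  have "h (Suc n) = (\<Sum>m\<le>n. of_nat (n choose m) * (f (Suc m) * g (n - m) + f m * g (Suc (n - m))))"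
    unfolding h_def by (rule sum_choose_Suc)
  also have "\<dots> = (\<Sum>m\<le>n. a * (of_nat (n choose m) * pderiv (f m * g (n - m)))
      + (p + q + of_nat n * b) * (of_nat (n choose m) * (f m * g (n - m))))"
  proof (intro sum.cong refl)
    fix m assume "m \<in> {..n}"
    then have "(of_nat n :: 'a poly) = of_nat m + of_nat (n - m)"
      by (simp flip: of_nat_add)
    then show "of_nat (n choose m) * (f (Suc m) * g (n - m) + f m * g (Suc (n - m))) =
        a * (of_nat (n choose m) * pderiv (f m * g (n - m)))
        + (p + q + of_nat n * b) * (of_nat (n choose m) * (f m * g (n - m)))"
      by (simp add: f g pderiv_mult algebra_simps)
  qed
  also have "\<dots> = a * pderiv (h n) + (p + q + of_nat n * b) * h n"
    unfolding h_def pderiv_sum pderiv_of_nat_mult by (simp only: sum.distrib sum_distrib_left)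
  finally show ?thesis .
qed

text \<open>
  The coefficients of \<open>1 - \<Sum>\<^sub>n t\<^sub>n z\<^sup>n / n!\<close>, an exponential generating function that equals
  \<open>cosh (s z) - (1 + x) / s * sinh (s z)\<close> with \<open>s\<^sup>2 = 1 - x\<^sup>2\<close>.
\<close>

definition kernel_poly :: "nat \<Rightarrow> int poly" where
  "kernel_poly n = (if n = 0 then 1 else - t_poly n)"

lemma kernel_poly_even: "kernel_poly (2 * k) = (1 - poly_x ^ 2) ^ k"
  by (simp add: kernel_poly_def t_poly_def)

lemma kernel_poly_odd: "kernel_poly (Suc (2 * k)) = - ((1 + poly_x) * (1 - poly_x ^ 2) ^ k)"
  by (simp add: kernel_poly_def t_poly_def)

lemma kernel_poly_Suc:
  "kernel_poly (Suc n) = 2 * poly_x * (1 - poly_x ^ 2) * pderiv (kernel_poly n)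
     + (- 1 - poly_x + of_nat n * (2 * poly_x ^ 2)) * kernel_poly n"
proof -
  define x where "x = poly_x"
  define y where "y = 1 - x ^ 2"
  have dx: "pderiv x = 1" by (simp add: x_def pderiv_x)
  have D: "y * pderiv (y ^ k) = - (of_nat (2 * k) * x * y ^ k)" for k
    unfolding y_def x_def by (rule pderiv_one_minus_x2_power)
  show ?thesis
  proof (cases "even n")
    case True
    then obtain k where n: "n = 2 * k" by auto
    have "2 * x * y * pderiv (y ^ k) = 2 * x * (y * pderiv (y ^ k))" by (simp only: mult.assoc)
    also have "\<dots> = - (2 * x * of_nat (2 * k) * x * y ^ k)" unfolding D by (simp add: algebra_simps)
    finally have "2 * x * y * pderiv (y ^ k) + (- 1 - x + of_nat (2 * k) * (2 * x ^ 2)) * y ^ k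
        = - ((1 + x) * y ^ k)"
      by (simp add: algebra_simps power2_eq_square)
    then show ?thesis unfolding n kernel_poly_even kernel_poly_odd y_def x_def by simp
  next
    case False
    then obtain k where n: "n = Suc (2 * k)" by (auto elim: oddE)
    have "pderiv (- ((1 + x) * y ^ k)) = - (y ^ k + (1 + x) * pderiv (y ^ k))"
      by (simp only: pderiv_minus pderiv_mult pderiv_add dx pderiv_1) (simp add: algebra_simps)
    moreover have "2 * x * y * - (z + (1 + x) * d) = - (2 * x * y * z) - 2 * x * (1 + x) * (y * d)" for z d
      by (simp add: algebra_simps)
    ultimately have "2 * x * y * pderiv (- ((1 + x) * y ^ k))
        = - (2 * x * y * y ^ k) - 2 * x * (1 + x) * (y * pderiv (y ^ k))"
      by (simp only:)
    also have "\<dots> = - (2 * x * y * y ^ k) + 2 * x * (1 + x) * of_nat (2 * k) * x * y ^ k"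
      unfolding D by (simp add: algebra_simps)
    finally have "2 * x * y * pderiv (- ((1 + x) * y ^ k))
        + (- 1 - x + of_nat (Suc (2 * k)) * (2 * x ^ 2)) * (- ((1 + x) * y ^ k))
        = (- 2 * x * y + (1 + x) * (1 + x) - 2 * x ^ 2 * (1 + x)) * y ^ k"
      by (simp add: algebra_simps power2_eq_square)
    also have "\<dots> = y ^ Suc k" unfolding power_Suc
      by (rule arg_cong[of _ _ "\<lambda>z. z * y ^ k"]) (simp add: y_def algebra_simps power2_eq_square)
    finally have "y ^ Suc k = 2 * x * y * pderiv (- ((1 + x) * y ^ k))
        + (- 1 - x + of_nat (Suc (2 * k)) * (2 * x ^ 2)) * (- ((1 + x) * y ^ k))" ..
    moreover have "kernel_poly (Suc n) = y ^ Suc k"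
      using kernel_poly_even[of "Suc k"] by (simp add: n y_def x_def)
    ultimately show ?thesis unfolding n kernel_poly_odd y_def x_def by simp
  qed
qed

text \<open>
  The recurrence of the up-down run polynomials, rewritten for the sequence \<open>2 ^ n x S\<^sub>n\<close> in such a
  form that its coefficients are those of the binomial convolution of the shifted sequence
  \<open>T\<^sub>m\<^sub>+\<^sub>1\<close> with the kernel polynomials.
\<close>

lemma scaled_up_down_run_poly_Suc:
  "2 ^ Suc n * poly_x * up_down_run_poly (Suc n)
   = 2 * poly_x * (1 - poly_x ^ 2) * pderiv (2 ^ n * poly_x * up_down_run_poly n)
     + ((3 * poly_x - 1 + 2 * poly_x ^ 2) + (- 1 - poly_x) + of_nat n * (2 * poly_x ^ 2))
       * (2 ^ n * poly_x * up_down_run_poly n)"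
proof -
  define x where "x = poly_x"
  define s where "s = up_down_run_poly n"
  have "pderiv x = 1" by (simp add: x_def pderiv_x)
  then have "pderiv (of_nat k * (x * s)) = of_nat k * (s + x * pderiv s)" for k
    unfolding pderiv_of_nat_mult pderiv_mult by (simp add: add.commute)
  from this[of "2 ^ n"] have "pderiv (2 ^ n * (x * s)) = 2 ^ n * (s + x * pderiv s)"
    by (simp only: of_nat_power of_nat_numeral)
  moreover have "2 ^ Suc n * x * (x * (1 - x ^ 2) * d + (x + of_nat n * x ^ 2) * s)
      = 2 * x * (1 - x ^ 2) * (2 ^ n * (s + x * d))
      + ((3 * x - 1 + 2 * x ^ 2) + (- 1 - x) + of_nat n * (2 * x ^ 2)) * (2 ^ n * (x * s))" for d
    by (simp add: algebra_simps power2_eq_square)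
  ultimately show ?thesis
    unfolding up_down_run_poly_Suc x_def[symmetric] s_def[symmetric] by (simp only: mult.assoc)
qed

text \<open>
  Both sides satisfy the same first-order recurrence and start with \<open>x\<close>.
\<close>

lemma scaled_up_down_run_poly_eq_convolution:
  "2 ^ n * poly_x * up_down_run_poly n
   = (\<Sum>m\<le>n. of_nat (n choose m) * (up_signed_run_poly (Suc m) * kernel_poly (n - m)))"
proof (induction n)
  case 0
  show ?case using up_signed_run_poly_1 by (simp add: up_down_run_poly_0 kernel_poly_def)
next
  case (Suc n)
  have "up_signed_run_poly (Suc (Suc m)) = 2 * poly_x * (1 - poly_x ^ 2) * pderiv (up_signed_run_poly (Suc m))
     + ((3 * poly_x - 1 + 2 * poly_x ^ 2) + of_nat m * (2 * poly_x ^ 2)) * up_signed_run_poly (Suc m)" for m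
  proof -
    define x where "x = poly_x"
    show ?thesis
      using up_signed_run_poly_Suc[of "Suc m"] unfolding x_def[symmetric] by (simp add: algebra_simps)
  qed
  note binomial_convolution_recurrence[OF this kernel_poly_Suc]
  then show ?case unfolding scaled_up_down_run_poly_Suc Suc.IH by simp
qed

section \<open>The Hessenberg determinant\<close>

text \<open>
  The hypotheses on \<open>v\<close> say that the matrix maps the vector \<open>(v 0, \<dots>, v n)\<close>, whose first entry is 1, to
  \<open>v (n + 1)\<close> times the last unit vector. Replacing the first column by this image does not change
  the determinant. What remains after deleting the first column and the last row is lower
  triangular with diagonal \<open>- 1\<close>, and its determinant cancels the sign of the cofactor.
\<close>

lemma det_hessenberg:
  fixes m :: "nat \<Rightarrow> nat \<Rightarrow> 'a::comm_ring_1"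
  assumes super: "\<And>i. i < n \<Longrightarrow> m i (Suc i) = - 1"
    and zero: "\<And>i j. Suc i < j \<Longrightarrow> m i j = 0"
    and v0: "v 0 = 1"
    and v: "\<And>i. i \<le> n \<Longrightarrow> v (Suc i) = (\<Sum>j\<le>i. m i j * v j)"
  shows "det (mat (Suc n) (Suc n) (\<lambda>(i, j). m i j)) = v (Suc n)"
proof -
  let ?N = "Suc n"
  define M where "M = mat ?N ?N (\<lambda>(i, j). m i j)"
  (* Multiplying by P from the right replaces the first column of M by the image of v. *)
  define P where "P = mat ?N ?N (\<lambda>(i, j). if j = 0 then v i else if i = j then 1 else 0)"
  define Q where "Q = mat ?N ?N (\<lambda>(i, j). if j = 0 then if i = n then v ?N else 0 else m i j)"
  have carrier: "M \<in> carrier_mat ?N ?N" "P \<in> carrier_mat ?N ?N" "Q \<in> carrier_mat ?N ?N"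
    by (auto simp: M_def P_def Q_def)
  have row: "(\<Sum>k<?N. m i k * v k) = (if i = n then v ?N else 0)" if "i \<le> n" for i
  proof (cases "i = n")
    case True
    then show ?thesis by (simp add: v flip: lessThan_Suc_atMost)
  next
    case False
    then have "i < n" using that by simp
    have "(\<Sum>k<?N. m i k * v k) = (\<Sum>k\<le>Suc i. m i k * v k)"
      by (rule sum.mono_neutral_right) (use \<open>i < n\<close> zero in auto)
    also have "\<dots> = 0" using super[OF \<open>i < n\<close>] v[of i] that by simp
    finally show ?thesis using False by simp
  qed
  have "M * P = Q"
  proof (rule eq_matI)
    fix i j assume "i < dim_row Q" "j < dim_col Q"
    then have ij: "i < ?N" "j < ?N" by (auto simp: Q_def)
    then have "(M * P) $$ (i, j) = (\<Sum>k<?N. m i k * (if j = 0 then v k else if k = j then 1 else 0))"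
      by (simp add: M_def P_def scalar_prod_def atLeast0LessThan)
    also have "\<dots> = Q $$ (i, j)"
      using ij row[of i] by (cases "j = 0") (simp_all add: Q_def if_distrib[of "(*) _"] cong: if_cong del: sum.lessThan_Suc)
    finally show "(M * P) $$ (i, j) = Q $$ (i, j)" .
  qed (auto simp: M_def P_def Q_def)
  have "det P = 1"
  proof -
    have "det P = prod_list (diag_mat P)"
      by (rule det_lower_triangular[OF _ carrier(2)]) (auto simp: P_def)
    also have "diag_mat P = map (\<lambda>i. 1) [0..<?N]"
      unfolding diag_mat_def by (rule map_cong) (auto simp: P_def v0)
    finally show ?thesis by (simp add: map_replicate_const prod_list_replicate)
  qed
  then have "det M = det Q" using det_mult[OF carrier(1,2)] \<open>M * P = Q\<close> by simp
  also have "\<dots> = (\<Sum>i<?N. Q $$ (i, 0) * cofactor Q i 0)"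
    by (rule laplace_expansion_column[OF carrier(3)]) simp
  also have "\<dots> = v ?N * cofactor Q n 0"
    by (simp add: Q_def)
  also have "cofactor Q n 0 = 1"
  proof -
    define R where "R = mat_delete Q n 0"
    have R: "R \<in> carrier_mat n n" using carrier(3) by (simp add: R_def mat_delete_def)
    have R_entry: "R $$ (i, j) = m i (Suc j)" if "i < n" "j < n" for i j
      using that by (simp add: R_def mat_delete_def Q_def)
    have "det R = prod_list (diag_mat R)"
      by (rule det_lower_triangular[OF _ R]) (auto simp: R_entry zero)
    also have "diag_mat R = map (\<lambda>i. - 1) [0..<n]"
      unfolding diag_mat_def using R by (intro map_cong) (auto simp: R_entry super)
    finally have "det R = (- 1) ^ n" by (simp add: map_replicate_const prod_list_replicate)
    then show ?thesis by (simp add: cofactor_def R_def flip: power_mult_distrib)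
  qed
  finally show ?thesis by (simp add: M_def)
qed

text \<open>
  The convolution identity solved for its term with \<open>m = n\<close>.
\<close>

lemma up_signed_run_poly_eq_hessenberg_row:
  "up_signed_run_poly (Suc n) = hessenberg_entry n 0
     + (\<Sum>m<n. hessenberg_entry n (Suc m) * up_signed_run_poly (Suc m))"
proof -
  have "hessenberg_entry n 0 = 2 ^ n * poly_x * up_down_run_poly n"
    by (simp add: hessenberg_entry_def up_down_run_poly_0)
  also have "\<dots> = up_signed_run_poly (Suc n)
      + (\<Sum>m<n. of_nat (n choose m) * (up_signed_run_poly (Suc m) * kernel_poly (n - m)))"
    unfolding scaled_up_down_run_poly_eq_convolution lessThan_Suc_atMost[symmetric]
    by (simp add: kernel_poly_def)
  also have "(\<Sum>m<n. of_nat (n choose m) * (up_signed_run_poly (Suc m) * kernel_poly (n - m)))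
      = (\<Sum>m<n. - (hessenberg_entry n (Suc m) * up_signed_run_poly (Suc m)))"
    by (rule sum.cong[OF refl]) (simp add: hessenberg_entry_def kernel_poly_def Suc_diff_Suc)
  finally show ?thesis by (simp add: sum_negf)
qed

theorem theorem18:
  fixes n :: nat
  assumes "n \<ge> 1"
  shows "up_signed_run_poly (n + 1)
           = det (mat (n + 1) (n + 1) (\<lambda>(i, j). hessenberg_entry i j))"
proof -
  define v where "v j = (if j = 0 then 1 else up_signed_run_poly j)" for j
  have "v (Suc i) = (\<Sum>j\<le>i. hessenberg_entry i j * v j)" for i
    unfolding lessThan_Suc_atMost[symmetric] sum.lessThan_Suc_shift
    by (simp add: v_def up_signed_run_poly_eq_hessenberg_row[of i])
  then have "det (mat (Suc n) (Suc n) (\<lambda>(i, j). hessenberg_entry i j)) = v (Suc n)"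
    by (intro det_hessenberg) (auto simp: v_def hessenberg_entry_def)
  then show ?thesis by (simp add: v_def)
qed

end
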